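(* Let $q=2n+1$ be an odd prime power, let $\chi$ be a generator of the cyclic group of multiplicative characters of $\mathbb{F}_q$, and write $\mathbb{F}_q^{\times 2}=\{x^2: x\in\mathbb{F}_q^\times\}=\{\alpha_1,\dots,\alpha_n\}$. For $d\in\mathbb{F}_q^\times$ and an integer $1\le r\le q-2$ define the complex determinant $$S_q(r,d)=\det\left[\chi^r(\alpha_i+d\alpha_j)\right]_{1\le i,j\le n}.$$ Then: (i) If $d\notin\mathbb{F}_q^{\times 2}$ and $r\equiv n\pmod 2$, then $S_q(r,d)=0$. (ii) If $d\in\mathbb{F}_q^{\times2}$ and $q\equiv 3\pmod 4$, then $S_q(r,d)=S_q(r,1)$, and $$S_q(r,1)=\frac{q^n}{2^n}\prod_{k=1}^n\left({}_2F_1\left(\begin{array}{cc}\varepsilon&\chi^r\\ &\chi^k\end{array}\bigg|1\right)-{}_2F_1\left(\begin{array}{cc}\phi&\chi^r\\ &\chi^k\end{array}\bigg|1\right)\right).$$ (iii) If $d\in\mathbb{F}_q^{\times2}$ and $q\equiv1\pmod 4$, then $S_q(r,d)=\delta_dS_q(r,1)$, where $\delta_d=1$ if $d$ is a fourth power in $\mathbb{F}_q$ and $\delta_d=-1$ otherwise, and $$S_q(r,1)=\frac{q^n(-1)^{r+n(n+1)/2}}{2^n}\prod_{k=1}^n{}_2F_1\left(\begin{array}{cc}\chi^{-r}&\chi^{2k-2r}\\ &\chi^{2k-r}\end{array}\bigg|-1\right).$$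
   Context: All multiplicative characters $\psi$ of $\mathbb{F}_q$ (including the trivial one) are extended to $\mathbb{F}_q$ by $\psi(0)=0$. $\varepsilon$ denotes the trivial multiplicative character and $\phi$ the unique quadratic multiplicative character of $\mathbb{F}_q$; $\overline{B}$ denotes the inverse character of $B$. Greene's binomial coefficient is $\binom{A}{B}=\frac{B(-1)}{q}J(A,\overline{B})$ with the Jacobi sum $J(A,B)=\sum_{x\in\mathbb{F}_q}A(x)B(1-x)$. Greene's hypergeometric function is $${}_2F_1\left(\begin{array}{cc}A&B\\ &C\end{array}\bigg|x\right)=\frac{q}{q-1}\sum_{\psi}\binom{A\psi}{\psi}\binom{B\psi}{C\psi}\psi(x),$$ the sum over all multiplicative characters $\psi$ of $\mathbb{F}_q$; equivalently ${}_2F_1\left(\begin{array}{cc}A&B\\ &C\end{array}\big|x\right)=\varepsilon(x)\frac{BC(-1)}{q}\sum_{y\in\mathbb{F}_q}B(y)\overline{B}C(1-y)\overline{A}(1-xy)$. *)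

theory Defs
  imports Complex_Main "HOL-Library.Cardinality" "Jordan_Normal_Form.Determinant"
begin

text \<open>The field with \<open>q\<close> elements is a type \<open>'a\<close> of sort \<open>{field, finite}\<close>, with \<open>q = CARD('a)\<close>.\<close>

definition mult_char :: "('a::{field,finite} \<Rightarrow> complex) \<Rightarrow> bool" where
  "mult_char \<psi> \<longleftrightarrow>
     \<psi> 0 = 0 \<and> (\<forall>x. x \<noteq> 0 \<longrightarrow> \<psi> x \<noteq> 0) \<and> (\<forall>x y. \<psi> (x * y) = \<psi> x * \<psi> y)"

definition triv_char :: "'a::{field,finite} \<Rightarrow> complex" where
  "triv_char x = (if x = 0 then 0 else 1)"

definition char_mult :: "('a::{field,finite} \<Rightarrow> complex) \<Rightarrow> ('a \<Rightarrow> complex) \<Rightarrow> 'a \<Rightarrow> complex" where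
  "char_mult A B x = A x * B x"

definition char_inv :: "('a::{field,finite} \<Rightarrow> complex) \<Rightarrow> 'a \<Rightarrow> complex" where
  "char_inv A x = inverse (A x)"

text \<open>The case distinction is needed because \<open>0 powi 0 = 1\<close>, whereas the zeroth power of a
  character is the trivial character, which vanishes at \<open>0\<close>.\<close>

definition char_pow :: "('a::{field,finite} \<Rightarrow> complex) \<Rightarrow> int \<Rightarrow> 'a \<Rightarrow> complex" where
  "char_pow A k x = (if x = 0 then 0 else A x powi k)"

definition char_generator :: "('a::{field,finite} \<Rightarrow> complex) \<Rightarrow> bool" where
  "char_generator \<chi> \<longleftrightarrow> mult_char \<chi> \<and> {\<psi>. mult_char \<psi>} = range (char_pow \<chi>)"

text \<open>The character of order two; it exists and is unique when \<open>q\<close> is odd.\<close>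

definition quad_char :: "'a::{field,finite} \<Rightarrow> complex" where
  "quad_char = (THE \<psi>. mult_char \<psi> \<and> \<psi> \<noteq> triv_char \<and> char_mult \<psi> \<psi> = triv_char)"

definition jacobi_sum :: "('a::{field,finite} \<Rightarrow> complex) \<Rightarrow> ('a \<Rightarrow> complex) \<Rightarrow> complex" where
  "jacobi_sum A B = (\<Sum>x\<in>UNIV. A x * B (1 - x))"

definition greene_binom :: "('a::{field,finite} \<Rightarrow> complex) \<Rightarrow> ('a \<Rightarrow> complex) \<Rightarrow> complex" where
  "greene_binom A B = B (- 1) / of_nat CARD('a) * jacobi_sum A (char_inv B)"

text \<open>\<open>greene_2F1 A B C x\<close> has upper row \<open>A\<close>, \<open>B\<close> and lower row \<open>C\<close>.\<close>

definition greene_2F1 ::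
  "('a::{field,finite} \<Rightarrow> complex) \<Rightarrow> ('a \<Rightarrow> complex) \<Rightarrow> ('a \<Rightarrow> complex) \<Rightarrow> 'a \<Rightarrow> complex" where
  "greene_2F1 A B C x =
     of_nat CARD('a) / (of_nat CARD('a) - 1) *
     (\<Sum>\<psi> | mult_char \<psi>.
        greene_binom (char_mult A \<psi>) \<psi> * greene_binom (char_mult B \<psi>) (char_mult C \<psi>) * \<psi> x)"

definition nonzero_squares :: "'a::{field,finite} set" where
  "nonzero_squares = {x\<^sup>2 | x. x \<noteq> 0}"

text \<open>Matrices of \<open>Jordan_Normal_Form\<close> are indexed from \<open>0\<close>, so the entry with indices
  \<open>i\<close>, \<open>j\<close> belongs to \<open>\<alpha> (i + 1)\<close> and \<open>\<alpha> (j + 1)\<close>.\<close>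

definition S_det ::
  "nat \<Rightarrow> (nat \<Rightarrow> 'a::{field,finite}) \<Rightarrow> ('a \<Rightarrow> complex) \<Rightarrow> nat \<Rightarrow> 'a \<Rightarrow> complex" where
  "S_det n \<alpha> \<chi> r d =
     det (mat n n (\<lambda>(i, j). char_pow \<chi> (int r) (\<alpha> (i + 1) + d * \<alpha> (j + 1))))"

end

theory Submission
  imports Defs "HOL-Algebra.Multiplicative_Group"
begin

text \<open>
  The matrix is \<open>diag(\<chi>\<^sup>r(\<alpha>\<^sub>i))\<close> times the matrix \<open>\<chi>\<^sup>r(1 + d \<alpha>\<^sub>j / \<alpha>\<^sub>i)\<close> of a convolution on the
  cyclic group of nonzero squares. Hence its determinant is \<open>(-1)\<close> to the power \<open>r (n + 1)\<close> times the
  product of the eigenvalues \<open>\<mu>\<^sub>d(k) = \<Sum> \<chi>\<^sup>r(1 + d z) \<chi>\<^sup>k(z)\<close>, where \<open>z\<close> runs over the nonzero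
  squares and \<open>k\<close> over any \<open>n\<close> consecutive integers.

  The substitution \<open>z \<mapsto> 1 / (d\<^sup>2 z)\<close> relates \<open>\<mu>\<^sub>d(k)\<close> to \<open>\<mu>\<^sub>d(- r - k)\<close>; for a nonsquare \<open>d\<close> and
  \<open>2 k = n - r\<close> this reads \<open>\<mu>\<^sub>d(k) = - \<mu>\<^sub>d(k)\<close>. For a square \<open>d\<close>, the substitution \<open>z \<mapsto> z / d\<close>
  reduces to \<open>d = 1\<close>. Finally, orthogonality of characters turns Greene's function into a sum over
  the field, which for the parameters in question is supported on the squares (through
  \<open>\<epsilon> - \<phi>\<close> if \<open>n\<close> is odd, and because the summand depends on \<open>y\<^sup>2\<close> only if \<open>n\<close> is even), so that it
  is \<open>2 \<mu>\<^sub>1(k - r) / q\<close> up to sign.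
\<close>

section \<open>Cyclicity of the unit group and basic facts on multiplicative characters\<close>

text \<open>The result of HOL-Algebra on the multiplicative group of a finite field is carried over
  by packing the operations of the type into the record \<open>R\<close> with carrier
  \<open>UNIV\<close>.\<close>

lemma units_generator_exists:
  "\<exists>g::'a::{field,finite}. g \<noteq> 0 \<and> (\<forall>x. x \<noteq> 0 \<longrightarrow> (\<exists>i::nat. x = g ^ i))"
proof -
  define R :: "'a ring" where
    "R = \<lparr>carrier = UNIV, monoid.mult = (*), one = 1, zero = 0, add = (+)\<rparr>"
  have R: "carrier R = UNIV" "\<zero>\<^bsub>R\<^esub> = 0" "\<one>\<^bsub>R\<^esub> = 1"
    "\<And>x y. x \<otimes>\<^bsub>R\<^esub> y = x * y" "\<And>x y. x \<oplus>\<^bsub>R\<^esub> y = x + y"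
    by (simp_all add: R_def)
  have "cring R"
  proof (rule cringI)
    show "abelian_group R"
      by (rule abelian_groupI) (auto simp: R add_ac intro: exI[of _ "- _"] left_minus)
    show "comm_monoid R"
      by (rule comm_monoidI) (auto simp: R mult_ac)
  qed (auto simp: R algebra_simps)
  then have "Ring.field R"
  proof (rule cring.cring_fieldI2)
    fix a assume "a \<noteq> \<zero>\<^bsub>R\<^esub>"
    then show "\<exists>b\<in>carrier R. a \<otimes>\<^bsub>R\<^esub> b = \<one>\<^bsub>R\<^esub>"
      by (intro bexI[of _ "inverse a"]) (auto simp: R)
  qed (auto simp: R)
  then interpret F: Ring.field R .
  obtain g where g: "g \<in> carrier (mult_of R)"
    "carrier (mult_of R) = {g [^]\<^bsub>R\<^esub> i | i::nat. i \<in> UNIV}"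
    using F.finite_field_mult_group_has_gen R(1) by auto
  have "g [^]\<^bsub>R\<^esub> i = g ^ i" for i :: nat
    by (induction i) (simp_all add: R mult.commute)
  with g show ?thesis
    by (intro exI[of _ g]) (auto simp: R carrier_mult_of)
qed

lemma power_mod_period:
  fixes x :: "'b::monoid_mult"
  assumes "x ^ m = 1"
  shows "x ^ i = x ^ (i mod m)"
proof -
  have "x ^ i = x ^ (m * (i div m) + i mod m)" by simp
  also have "\<dots> = x ^ (i mod m)"
    by (simp only: power_add power_mult assms) simp
  finally show ?thesis .
qed

lemma mult_char_1:
  assumes "mult_char \<psi>"
  shows "\<psi> 1 = 1"
proof -
  have "\<psi> (1 * 1) = \<psi> 1 * \<psi> 1" using assms unfolding mult_char_def by blast
  moreover have "\<psi> 1 \<noteq> 0" using assms by (simp add: mult_char_def)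
  ultimately show ?thesis by simp
qed

lemma mult_char_power:
  assumes "mult_char \<psi>"
  shows "\<psi> (x ^ i) = \<psi> x ^ i"
  using assms mult_char_1[OF assms] by (induction i) (auto simp: mult_char_def)

lemma mult_char_inverse:
  assumes "mult_char \<psi>"
  shows "\<psi> (inverse x) = inverse (\<psi> x)"
proof (cases "x = 0")
  case False
  have "\<psi> x * \<psi> (inverse x) = \<psi> (x * inverse x)" using assms by (simp add: mult_char_def)
  with False have "\<psi> x * \<psi> (inverse x) = 1"
    using mult_char_1[OF assms] by simp
  then show ?thesis by (simp add: inverse_unique)
qed (use assms in \<open>auto simp: mult_char_def\<close>)

lemma mult_char_triv: "mult_char triv_char"
  by (auto simp: mult_char_def triv_char_def)

lemma mult_char_mult: "mult_char A \<Longrightarrow> mult_char B \<Longrightarrow> mult_char (char_mult A B)"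
  by (auto simp: mult_char_def char_mult_def)

lemma mult_char_pow: "mult_char A \<Longrightarrow> mult_char (char_pow A k)"
  by (auto simp: mult_char_def char_pow_def power_int_mult_distrib)

section \<open>Primitive roots, squares and the generating character\<close>

text \<open>The primitive root \<open>g\<close> turns statements on units into statements on
  exponents modulo \<open>2 * n = q - 1\<close>.\<close>

locale character_generator =
  fixes n :: nat and \<chi> :: "'a::{field,finite} \<Rightarrow> complex" and g :: 'a
  assumes card_field: "CARD('a) = 2 * n + 1"
    and generator: "char_generator \<chi>"
    and g_nonzero: "g \<noteq> 0"
    and g_generates: "x \<noteq> 0 \<Longrightarrow> \<exists>i::nat. x = g ^ i"
begin

lemma mult_char: "mult_char \<chi>"
  using generator by (simp add: char_generator_def)

lemma n_pos: "n > 0"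
proof -
  have "card {0, 1::'a} \<le> CARD('a)" by (rule card_mono) auto
  then show ?thesis using card_field by simp
qed

lemma card_units: "card (- {0::'a}) = 2 * n"
  using card_field by (simp add: Compl_eq_Diff_UNIV card_Diff_singleton)

text \<open>Multiplication by \<open>x\<close> permutes the units, so the product of all units is
  unchanged by the factor \<open>x ^ (2 * n)\<close>.\<close>

lemma power_card:
  assumes "x \<noteq> (0::'a)"
  shows "x ^ (2 * n) = 1"
proof -
  have b: "bij_betw ((*) x) (- {0}) (- {0})"
    by (rule bij_betwI[where g = "\<lambda>y. y / x"]) (use assms in auto)
  have "\<Prod>(- {0::'a}) = (\<Prod>y\<in>-{0}. x * y)"
    using prod.reindex_bij_betw[OF b, of "\<lambda>y. y"] by simp
  also have "\<dots> = x ^ (2 * n) * \<Prod>(- {0})"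
    by (simp add: prod.distrib card_units)
  finally show ?thesis by simp
qed

lemma g_power_bij: "bij_betw (\<lambda>i. g ^ i) {..<2 * n} (- {0})"
proof -
  have "- {0} \<subseteq> (\<lambda>i. g ^ i) ` {..<2 * n}"
  proof
    fix x :: 'a assume "x \<in> - {0}"
    then obtain i where i: "x = g ^ i" using g_generates by auto
    have "g ^ i = g ^ (i mod (2 * n))"
      by (rule power_mod_period[OF power_card[OF g_nonzero]])
    then show "x \<in> (\<lambda>i. g ^ i) ` {..<2 * n}" using i n_pos by auto
  qed
  then have im: "(\<lambda>i. g ^ i) ` {..<2 * n} = - {0}" using g_nonzero by auto
  have "inj_on (\<lambda>i. g ^ i) {..<2 * n}"
    by (rule eq_card_imp_inj_on) (simp_all add: im card_units)
  with im show ?thesis by (simp add: bij_betw_def)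
qed

lemma g_power_eq_iff: "i < 2 * n \<Longrightarrow> j < 2 * n \<Longrightarrow> g ^ i = g ^ j \<longleftrightarrow> i = j"
  using g_power_bij by (auto simp: bij_betw_def inj_on_def)

text \<open>Some power of \<open>\<chi>\<close> must be the character that sends \<open>g\<close> to
  the primitive root of unity \<open>w\<close>. As \<open>w\<close> is then a power of
  \<open>\<chi> g\<close>, the order of \<open>\<chi> g\<close> is no smaller than
  \<open>2 * n\<close>.\<close>

lemma chi_g_power_eq_1_iff: "\<chi> g ^ i = 1 \<longleftrightarrow> 2 * n dvd i"
proof
  assume 1: "\<chi> g ^ i = 1"
  define w where "w = cis (2 * pi / real (2 * n))"
  have w_mod: "w ^ j = cis (2 * pi * real (j mod (2 * n)) / real (2 * n))" for j
  proof -
    have "w ^ (2 * n) = 1" using n_pos by (simp add: w_def DeMoivre)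
    then have "w ^ j = w ^ (j mod (2 * n))" by (rule power_mod_period)
    then show ?thesis by (simp add: w_def DeMoivre mult_ac)
  qed
  have w: "w ^ j = 1 \<longleftrightarrow> 2 * n dvd j" for j
  proof -
    have "inj_on (\<lambda>k. cis (2 * pi * real k / real (2 * n))) {..<2 * n}"
      using bij_betw_roots_unity[of "2 * n"] n_pos by (simp add: bij_betw_def)
    from inj_on_eq_iff[OF this, of "j mod (2 * n)" 0] n_pos
    have "w ^ j = 1 \<longleftrightarrow> j mod (2 * n) = 0"
      unfolding w_mod[of j] by simp
    then show ?thesis by (simp add: dvd_eq_mod_eq_0)
  qed
  \<comment> \<open>\<open>dl\<close> is the discrete logarithm to base \<open>g\<close>. By
    \<open>wcong\<close> below, \<open>w ^ dl x\<close> depends only on \<open>x\<close> and not on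
    the choice of the exponent, which makes \<open>\<psi>\<close> multiplicative.\<close>
  define dl where "dl = the_inv_into {..<2 * n} (\<lambda>i. g ^ i)"
  have dl: "g ^ dl x = x" if "x \<noteq> 0" for x
    unfolding dl_def
    by (rule f_the_inv_into_f_bij_betw[OF g_power_bij]) (use that in auto)
  have wcong: "w ^ j = w ^ k" if "g ^ j = g ^ k" for j k
  proof -
    have "g ^ (j mod (2 * n)) = g ^ (k mod (2 * n))"
      using that power_mod_period[OF power_card[OF g_nonzero]] by metis
    then have "j mod (2 * n) = k mod (2 * n)"
      using g_power_eq_iff n_pos by simp
    then show ?thesis by (simp add: w_mod)
  qed
  define \<psi> where "\<psi> x = (if x = 0 then 0 else w ^ dl x)" for x
  have "mult_char \<psi>"
    unfolding mult_char_def
  proof (intro conjI allI impI)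
    fix x y
    show "\<psi> (x * y) = \<psi> x * \<psi> y"
    proof (cases "x = 0 \<or> y = 0")
      case False
      then have "g ^ dl (x * y) = g ^ (dl x + dl y)"
        by (simp add: dl power_add)
      from wcong[OF this] False show ?thesis by (simp add: \<psi>_def power_add)
    qed (auto simp: \<psi>_def)
  qed (auto simp: \<psi>_def w_def)
  then obtain k where k: "\<psi> = char_pow \<chi> k"
    using generator unfolding char_generator_def by blast
  have "w = \<psi> g"
    using wcong[of "dl g" 1] dl[OF g_nonzero] g_nonzero by (simp add: \<psi>_def)
  also have "\<dots> = \<chi> g powi k" using g_nonzero by (simp add: k char_pow_def)
  finally have "w = \<chi> g powi k" .
  then have "w ^ i = \<chi> g powi (k * int i)"
    by (simp add: power_int_mult)
  also have "\<dots> = (\<chi> g ^ i) powi k"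
    by (simp add: power_int_mult mult.commute[of k])
  finally have "w ^ i = (\<chi> g ^ i) powi k" .
  with 1 w show "2 * n dvd i" by simp
next
  assume "2 * n dvd i"
  then obtain j where "i = 2 * n * j" by auto
  then show "\<chi> g ^ i = 1"
    using mult_char_power[OF mult_char, of g "2 * n"] power_card[OF g_nonzero]
      mult_char_1[OF mult_char]
    by (simp add: power_mult)
qed

lemma chi_nonzero: "x \<noteq> 0 \<Longrightarrow> \<chi> x \<noteq> 0"
  using mult_char by (simp add: mult_char_def)

lemma chi_0: "\<chi> 0 = 0"
  using mult_char by (simp add: mult_char_def)

lemma chi_mult: "\<chi> (x * y) = \<chi> x * \<chi> y"
  using mult_char by (simp add: mult_char_def)

lemmas chi_1 = mult_char_1[OF mult_char]
  and chi_power = mult_char_power[OF mult_char]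
  and chi_inverse = mult_char_inverse[OF mult_char]

text \<open>Since \<open>\<chi> g\<close> has the full order \<open>2 * n\<close>, the character is
  faithful.\<close>

lemma chi_eq_1_iff: "\<chi> x = 1 \<longleftrightarrow> x = 1"
proof
  assume 1: "\<chi> x = 1"
  then have "x \<noteq> 0" using chi_0 by auto
  then obtain i where i: "x = g ^ i" using g_generates by blast
  with 1 have "2 * n dvd i" by (simp add: chi_power chi_g_power_eq_1_iff)
  then obtain j where "i = 2 * n * j" by (elim dvdE)
  then show "x = 1" by (simp add: i power_mult[of _ "2 * n"] power_card[OF g_nonzero] del: power_mult)
qed (simp add: chi_1)

lemma chi_g_power_n: "\<chi> g ^ n = - 1"
proof -
  have "(\<chi> g ^ n)\<^sup>2 = 1"
    using chi_g_power_eq_1_iff[of "2 * n"] by (simp add: power_mult[symmetric] mult.commute)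
  moreover have "\<chi> g ^ n \<noteq> 1"
    using n_pos by (auto simp: chi_g_power_eq_1_iff dest: dvd_imp_le)
  ultimately show ?thesis by (simp add: power2_eq_1_iff)
qed

lemma g_power_n: "g ^ n = - 1"
proof -
  have "(g ^ n)\<^sup>2 = 1"
    using power_card[OF g_nonzero] by (simp add: power_mult[symmetric] mult.commute)
  moreover have "g ^ n \<noteq> 1"
    using chi_g_power_n chi_power[of g n] chi_1 by auto
  ultimately show ?thesis by (simp add: power2_eq_1_iff)
qed

lemma chi_minus_1: "\<chi> (- 1) = - 1"
  using chi_g_power_n chi_power[of g n] by (simp add: g_power_n)

lemma chi_power_n_square: "z \<in> nonzero_squares \<Longrightarrow> \<chi> z ^ n = 1"
  using power_card by (auto simp: nonzero_squares_def chi_power[symmetric] chi_1 power_mult[symmetric])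

text \<open>Euler's criterion: as \<open>\<chi> g ^ n = - 1\<close>, the power detects the parity of
  the discrete logarithm, which is odd for a nonsquare.\<close>

lemma chi_power_n:
  assumes "z \<noteq> 0"
  shows "\<chi> z ^ n = (if z \<in> nonzero_squares then 1 else - 1)"
proof (cases "z \<in> nonzero_squares")
  case False
  obtain i where i: "z = g ^ i" using assms g_generates by blast
  have "odd i"
  proof
    assume "even i"
    then obtain j where "z = (g ^ j)\<^sup>2"
      using i by (metis dvdE power_mult mult.commute)
    with False show False using g_nonzero by (auto simp: nonzero_squares_def)
  qed
  moreover have "\<chi> z ^ n = (\<chi> g ^ n) ^ i"
    by (simp add: i chi_power power_mult[symmetric] mult.commute)
  ultimately show ?thesis using False by (simp add: chi_g_power_n)
qed (simp add: chi_power_n_square)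

lemma square_iff: "z \<in> nonzero_squares \<longleftrightarrow> \<chi> z ^ n = 1"
proof (cases "z = 0")
  case True
  then show ?thesis using n_pos by (simp add: chi_0 nonzero_squares_def zero_power)
qed (simp add: chi_power_n)

text \<open>The squaring map on units is two-to-one, with fibres \<open>{x, - x}\<close>.\<close>

lemma sum_squares:
  fixes f :: "'a \<Rightarrow> complex"
  shows "(\<Sum>y\<in>- {0}. f (y\<^sup>2)) = (\<Sum>z\<in>nonzero_squares. 2 * f z)"
proof -
  have "(\<Sum>y\<in>- {0}. f (y\<^sup>2)) = (\<Sum>z\<in>nonzero_squares. \<Sum>y | y \<in> - {0} \<and> y\<^sup>2 = z. f (y\<^sup>2))"
    by (rule sum.group[symmetric]) (auto simp: nonzero_squares_def)
  also have "\<dots> = (\<Sum>z\<in>nonzero_squares. 2 * f z)"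
  proof (rule sum.cong[OF refl])
    fix z :: 'a assume "z \<in> nonzero_squares"
    then obtain x where x: "z = x\<^sup>2" "x \<noteq> 0" by (auto simp: nonzero_squares_def)
    \<comment> \<open>That the characteristic is not two is read off from
      \<open>\<chi> (- 1) = - 1\<close>.\<close>
    have "x \<noteq> - x"
    proof
      assume "x = - x"
      then have "1 = (- 1 :: 'a)"
        by (metis x(2) mult_minus1 mult_cancel_right1)
      then have "\<chi> 1 = - 1" using chi_minus_1 by metis
      then show False by (simp add: chi_1)
    qed
    moreover have "{y. y \<in> - {0} \<and> y\<^sup>2 = z} = {x, - x}"
      using x by (auto simp: power2_eq_iff)
    ultimately show "(\<Sum>y | y \<in> - {0} \<and> y\<^sup>2 = z. f (y\<^sup>2)) = 2 * f z"
      by (simp add: x)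
  qed
  finally show ?thesis .
qed

lemma squares_bij: "bij_betw (\<lambda>i. g ^ (2 * i)) {..<n} nonzero_squares"
  unfolding bij_betw_def
proof
  show "inj_on (\<lambda>i. g ^ (2 * i)) {..<n}"
    by (rule inj_onI) (simp add: g_power_eq_iff)
  show "(\<lambda>i. g ^ (2 * i)) ` {..<n} = nonzero_squares"
  proof
    show "(\<lambda>i. g ^ (2 * i)) ` {..<n} \<subseteq> nonzero_squares"
      using g_nonzero by (auto simp: nonzero_squares_def power_even_eq intro!: exI[of _ "g ^ i" for i])
    show "nonzero_squares \<subseteq> (\<lambda>i. g ^ (2 * i)) ` {..<n}"
    proof
      fix z :: 'a assume z: "z \<in> nonzero_squares"
      then have "z \<in> - {0}" by (auto simp: nonzero_squares_def)
      then obtain i where i: "i < 2 * n" "z = g ^ i"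
        using g_power_bij by (auto simp: bij_betw_def image_iff)
      \<comment> \<open>The discrete logarithm of a square is even, because \<open>\<chi>\<close> to
        the power \<open>n\<close> is trivial on squares.\<close>
      have "\<chi> z ^ n = (- 1) ^ i"
        by (simp add: i chi_power power_commuting_commutes flip: power_mult chi_g_power_n)
           (simp add: mult.commute)
      with z have "even i" by (simp add: chi_power_n_square uminus_power_if split: if_splits)
      then obtain j where "i = 2 * j" by (elim evenE)
      with i show "z \<in> (\<lambda>i. g ^ (2 * i)) ` {..<n}" by auto
    qed
  qed
qed

text \<open>The exponents \<open>2 * i\<close> add up to \<open>n * (n - 1)\<close>, and
  \<open>\<chi> g ^ n = - 1\<close>. The result, raised to the power \<open>r\<close>, is the
  determinant of the diagonal factor.\<close>

lemma prod_chi_squares: "(\<Prod>z\<in>nonzero_squares. \<chi> z) = (- 1) ^ (n + 1)"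
proof -
  have "(\<Prod>z\<in>nonzero_squares. \<chi> z) = (\<Prod>i<n. \<chi> g ^ (2 * i))"
    using prod.reindex_bij_betw[OF squares_bij, of \<chi>] by (simp add: chi_power)
  also have "\<dots> = \<chi> g ^ (\<Sum>i<n. 2 * i)" by (simp add: power_sum)
  also have "(\<Sum>i<n. 2 * i) = n * (n - 1)"
    by (induction n) (auto simp: algebra_simps diff_mult_distrib)
  also have "\<chi> g ^ (n * (n - 1)) = (- 1) ^ (n - 1)"
    by (simp add: power_mult chi_g_power_n)
  also have "\<dots> = (- 1) ^ (n + 1)"
    using n_pos by (cases n) auto
  finally show ?thesis .
qed

section \<open>Enumeration and orthogonality of the characters\<close>

lemma chi_powi_mod:
  assumes "x \<noteq> 0"
  shows "\<chi> x powi k = \<chi> x powi (k mod (2 * int n))"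
proof -
  have "k = 2 * int n * (k div (2 * int n)) + k mod (2 * int n)" by simp
  then have "\<chi> x powi k = \<chi> x powi (2 * int n * (k div (2 * int n))) * \<chi> x powi (k mod (2 * int n))"
    by (metis power_int_add chi_nonzero[OF assms])
  also have "\<chi> x powi (2 * int n * (k div (2 * int n))) = (\<chi> x ^ (2 * n)) powi (k div (2 * int n))"
    by (metis power_int_mult power_int_of_nat of_nat_mult of_nat_numeral)
  also have "\<chi> x ^ (2 * n) = 1"
    using power_card[OF assms] chi_1 by (simp flip: chi_power)
  finally show ?thesis by simp
qed

text \<open>Exponents can be reduced modulo \<open>2 * n\<close>, and faithfulness of
  \<open>\<chi>\<close>, tested at \<open>g\<close>, separates the remaining ones.\<close>

lemma characters_bij: "bij_betw (\<lambda>k. char_pow \<chi> (int k)) {..<2 * n} {\<psi>. mult_char \<psi>}"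
proof -
  have "char_pow \<chi> k \<in> (\<lambda>k. char_pow \<chi> (int k)) ` {..<2 * n}" for k
  proof
    show "char_pow \<chi> k = char_pow \<chi> (int (nat (k mod (2 * int n))))"
      using n_pos by (simp add: char_pow_def fun_eq_iff chi_powi_mod[of _ k])
    show "nat (k mod (2 * int n)) \<in> {..<2 * n}"
      using n_pos by (simp add: nat_less_iff)
  qed
  then have "(\<lambda>k. char_pow \<chi> (int k)) ` {..<2 * n} = {\<psi>. mult_char \<psi>}"
    using generator by (auto simp: char_generator_def)
  moreover have "inj_on (\<lambda>k. char_pow \<chi> (int k)) {..<2 * n}"
  proof (rule inj_onI)
    fix i j assume ij: "i \<in> {..<2 * n}" "j \<in> {..<2 * n}" "char_pow \<chi> (int i) = char_pow \<chi> (int j)"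
    from fun_cong[OF ij(3), of g] g_nonzero have "\<chi> (g ^ i) = \<chi> (g ^ j)"
      by (simp add: char_pow_def chi_power)
    then have "\<chi> (g ^ i / g ^ j) = 1"
      using g_nonzero by (simp add: divide_inverse chi_mult chi_inverse chi_nonzero)
    then have "g ^ i = g ^ j" using g_nonzero by (simp add: chi_eq_1_iff)
    with ij show "i = j" by (simp add: g_power_eq_iff)
  qed
  ultimately show ?thesis by (simp add: bij_betw_def)
qed

text \<open>Multiplication by \<open>\<chi>\<close> permutes the characters, so the sum equals
  \<open>\<chi> x\<close> times itself, and \<open>\<chi> x \<noteq> 1\<close> if
  \<open>x \<noteq> 1\<close>. At \<open>x = 0\<close> each character vanishes.\<close>

lemma sum_characters:
  fixes x :: 'a
  shows "(\<Sum>\<psi> | mult_char \<psi>. \<psi> x) = (if x = 1 then 2 * of_nat n else 0)"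
proof -
  have fin: "finite {\<psi> :: 'a \<Rightarrow> complex. mult_char \<psi>}"
    and card: "card {\<psi> :: 'a \<Rightarrow> complex. mult_char \<psi>} = 2 * n"
    using characters_bij bij_betw_finite[OF characters_bij] bij_betw_same_card[OF characters_bij]
    by auto
  consider "x = 1" | "x = 0" | "x \<noteq> 1" "x \<noteq> 0" by blast
  then show ?thesis
  proof cases
    case 1
    have "(\<Sum>\<psi> :: 'a \<Rightarrow> complex | mult_char \<psi>. \<psi> 1) = (\<Sum>\<psi> :: 'a \<Rightarrow> complex | mult_char \<psi>. 1)"
      by (rule sum.cong) (auto simp: mult_char_1)
    with 1 card show ?thesis by simp
  next
    case 2
    then show ?thesis by (simp add: mult_char_def)
  next
    case 3
    have "bij_betw (char_mult \<chi>) {\<psi>. mult_char \<psi>} {\<psi>. mult_char \<psi>}"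
    proof (rule bij_betwI)
      show "char_mult \<chi> \<in> {\<psi>. mult_char \<psi>} \<rightarrow> {\<psi>. mult_char \<psi>}"
        using mult_char by (auto intro: mult_char_mult)
      show "char_mult (char_pow \<chi> (- 1)) \<in> {\<psi>. mult_char \<psi>} \<rightarrow> {\<psi>. mult_char \<psi>}"
        using mult_char by (auto intro: mult_char_mult mult_char_pow)
    qed (use chi_nonzero in \<open>auto simp: char_mult_def char_pow_def fun_eq_iff mult_char_def power_int_minus\<close>)
    from sum.reindex_bij_betw[OF this, of "\<lambda>\<psi>. \<psi> x"]
    have "\<chi> x * (\<Sum>\<psi> | mult_char \<psi>. \<psi> x) = (\<Sum>\<psi> | mult_char \<psi>. \<psi> x)"
      by (simp add: char_mult_def sum_distrib_left)
    then show ?thesis using 3 by (simp add: chi_eq_1_iff)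
  qed
qed

text \<open>If the square of \<open>char_pow \<chi> k\<close> is trivial, then \<open>2 * n\<close>
  divides \<open>2 * k\<close>. Below \<open>2 * n\<close> this leaves the exponent
  \<open>0\<close>, which gives the trivial character, and \<open>n\<close>.\<close>

lemma quad_char_eq: "quad_char = char_pow \<chi> (int n)"
  unfolding quad_char_def
proof (rule the_equality, intro conjI)
  show "mult_char (char_pow \<chi> (int n))" by (rule mult_char_pow[OF mult_char])
  show "char_pow \<chi> (int n) \<noteq> triv_char"
    using g_nonzero chi_g_power_n
    by (auto simp: fun_eq_iff char_pow_def triv_char_def intro!: exI[of _ g])
  show "char_mult (char_pow \<chi> (int n)) (char_pow \<chi> (int n)) = triv_char"
    using chi_power_n by (auto simp: fun_eq_iff char_pow_def triv_char_def char_mult_def)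
next
  fix \<psi> :: "'a \<Rightarrow> complex"
  assume \<psi>: "mult_char \<psi> \<and> \<psi> \<noteq> triv_char \<and> char_mult \<psi> \<psi> = triv_char"
  then obtain k where k: "k < 2 * n" "\<psi> = char_pow \<chi> (int k)"
    using characters_bij by (auto simp: bij_betw_def)
  have "\<chi> g ^ (2 * k) = 1"
    using fun_cong[OF conjunct2[OF conjunct2[OF \<psi>]], of g] g_nonzero
    by (simp add: k char_pow_def char_mult_def triv_char_def power_add[symmetric] mult_2)
  then have "n dvd k" by (simp add: chi_g_power_eq_1_iff)
  then obtain j where j: "k = n * j" by (elim dvdE)
  have "j \<noteq> 0"
  proof
    assume "j = 0"
    then have "\<psi> = triv_char" by (simp add: k j char_pow_def triv_char_def fun_eq_iff)
    with \<psi> show False by simp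
  qed
  moreover have "j < 2" using k n_pos by (simp add: j)
  ultimately have "k = n" using j by (simp add: less_2_cases_iff)
  with k show "\<psi> = char_pow \<chi> (int n)" by simp
qed

section \<open>Greene's function as a sum over the field\<close>

text \<open>Both Jacobi sums are expanded, the sum over \<open>\<psi>\<close> is evaluated first,
  and orthogonality leaves at most one \<open>z\<close> for each \<open>y\<close>. The factor
  \<open>q - 1\<close> that it produces cancels the denominator in the definition of Greene's
  function.\<close>

lemma greene_2F1_integral:
  assumes A: "mult_char A" and B: "mult_char B" and C: "mult_char C" and x: "x \<noteq> (0::'a)"
  shows "greene_2F1 A B C x = B (- 1) * C (- 1) / of_nat CARD('a) *
    (\<Sum>y\<in>UNIV. B y * (inverse (B (1 - y)) * C (1 - y)) * inverse (A (1 - x * y)))"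
proof -
  define q :: complex where "q = of_nat CARD('a)"
  have q: "q - 1 = 2 * of_nat n" by (simp add: q_def card_field)
  have q0: "q \<noteq> 0" by (simp add: q_def)
  have vals: "A 0 = 0" "B 0 = 0" "C 0 = 0"
    "\<And>u v. A (u * v) = A u * A v" "\<And>u v. B (u * v) = B u * B v" "\<And>u v. C (u * v) = C u * C v"
    using A B C by (simp_all add: mult_char_def)
  \<comment> \<open>\<open>?c y z\<close> collects all arguments of \<open>\<psi>\<close>, and
    \<open>?w y z\<close> the factors free of \<open>\<psi>\<close>. For \<open>y = 1\<close> or
    \<open>z = 1\<close> the convention \<open>inverse 0 = 0\<close> makes \<open>?c y z\<close>
    zero, in accordance with \<open>\<psi> 0 = 0\<close>.\<close>
  let ?c = "\<lambda>y z. x * (y * z) * inverse ((1 - z) * (1 - y))"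
  let ?w = "\<lambda>y z. A z * (B y * inverse (C (1 - y)))"
  have summand: "greene_binom (char_mult A \<psi>) \<psi> * greene_binom (char_mult B \<psi>) (char_mult C \<psi>) * \<psi> x
      = C (- 1) / q\<^sup>2 * (\<Sum>y\<in>UNIV. \<Sum>z\<in>UNIV. ?w y z * \<psi> (?c y z))" if \<psi>: "mult_char \<psi>" for \<psi>
  proof -
    have m: "\<psi> (u * v) = \<psi> u * \<psi> v" for u v using \<psi> by (simp add: mult_char_def)
    have "\<psi> (- 1) * \<psi> (- 1) = 1" using m[of "- 1" "- 1"] mult_char_1[OF \<psi>] by simp
    then have "greene_binom (char_mult A \<psi>) \<psi> * greene_binom (char_mult B \<psi>) (char_mult C \<psi>) * \<psi> x
      = C (- 1) / q\<^sup>2 * (jacobi_sum (char_mult B \<psi>) (char_inv (char_mult C \<psi>)) *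
          jacobi_sum (char_mult A \<psi>) (char_inv \<psi>) * \<psi> x)"
      by (simp add: greene_binom_def q_def char_mult_def power2_eq_square)
    also have "jacobi_sum (char_mult B \<psi>) (char_inv (char_mult C \<psi>)) *
          jacobi_sum (char_mult A \<psi>) (char_inv \<psi>) * \<psi> x
        = (\<Sum>y\<in>UNIV. \<Sum>z\<in>UNIV. ?w y z * \<psi> (?c y z))"
      unfolding jacobi_sum_def sum_product unfolding sum_distrib_right
      by (intro sum.cong refl)
         (simp add: char_mult_def char_inv_def m mult_char_inverse[OF \<psi>] mult_ac del: inverse_mult_distrib
           add: inverse_mult_distrib[where 'a = complex])
    finally show ?thesis .
  qed
  have inner: "(\<Sum>z\<in>UNIV. ?w y z * (if ?c y z = 1 then q - 1 else 0))
      = (if y \<in> - {0, 1} then (q - 1) * (B y * inverse (C (1 - y)) * inverse (A (1 - x * (y / (y - 1))))) else 0)"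
    for y
  proof (cases "y \<in> - {0, 1}")
    case False
    then show ?thesis by (auto simp: vals)
  next
    case True
    then have y: "y \<noteq> 0" "y \<noteq> 1" "1 - y \<noteq> 0" "y - 1 \<noteq> 0" by auto
    \<comment> \<open>After clearing denominators, \<open>?c y z = 1\<close> is linear in
      \<open>z\<close>, and \<open>t\<close> is the reciprocal of its solution. If
      \<open>t = 0\<close> there is no solution, and \<open>inverse (A t)\<close> vanishes as
      well.\<close>
    define t where "t = 1 - x * (y / (y - 1))"
    have t: "t * (1 - y) = 1 - y + x * y"
      using y by (simp add: t_def field_simps)
    have "?c y z = 1 \<longleftrightarrow> t \<noteq> 0 \<and> z = inverse t" for z
    proof (cases "z = 1")
      case True
      \<comment> \<open>Here \<open>?c y z = 0\<close>, while \<open>z = inverse t\<close> would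
        mean \<open>t = 1\<close> and hence \<open>x * y = 0\<close>.\<close>
      then show ?thesis using x y by (auto simp: t_def)
    next
      case False
      then have "1 - z \<noteq> 0" by simp
      then have "(1 - z) * (1 - y) \<noteq> 0" using y by simp
      then have "?c y z = 1 \<longleftrightarrow> x * (y * z) = (1 - z) * (1 - y)"
        unfolding divide_inverse[symmetric] by (rule right_inverse_eq)
      also have "\<dots> \<longleftrightarrow> z * (1 - y + x * y) = 1 - y" by (auto simp: algebra_simps)
      also have "\<dots> \<longleftrightarrow> z * t = 1"
        using y by (simp flip: t add: mult.assoc[symmetric])
      also have "\<dots> \<longleftrightarrow> t \<noteq> 0 \<and> z = inverse t"
        by (auto intro: inverse_unique[symmetric] simp: mult.commute)
      finally show ?thesis .
    qed
    then have "(\<Sum>z\<in>UNIV. ?w y z * (if ?c y z = 1 then q - 1 else 0))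
        = (\<Sum>z\<in>UNIV. if z = inverse t then (if t \<noteq> 0 then ?w y z * (q - 1) else 0) else 0)"
      by (intro sum.cong) auto
    also have "\<dots> = (if t \<noteq> 0 then ?w y (inverse t) * (q - 1) else 0)"
      by (subst sum.delta) simp_all
    also have "\<dots> = (q - 1) * (B y * inverse (C (1 - y)) * inverse (A t))"
      by (simp add: mult_char_inverse[OF A] vals)
    finally show ?thesis using True by (simp add: t_def)
  qed
  have "(\<Sum>\<psi> | mult_char \<psi>. greene_binom (char_mult A \<psi>) \<psi>
        * greene_binom (char_mult B \<psi>) (char_mult C \<psi>) * \<psi> x)
      = (\<Sum>\<psi> | mult_char \<psi>. C (- 1) / q\<^sup>2 * (\<Sum>y\<in>UNIV. \<Sum>z\<in>UNIV. ?w y z * \<psi> (?c y z)))"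
    by (intro sum.cong refl summand) simp
  also have "\<dots> = C (- 1) / q\<^sup>2 *
      (\<Sum>y\<in>UNIV. \<Sum>z\<in>UNIV. ?w y z * (\<Sum>\<psi> | mult_char \<psi>. \<psi> (?c y z)))"
  proof -
    have "(\<Sum>\<psi> | mult_char \<psi>. \<Sum>y\<in>UNIV. \<Sum>z\<in>UNIV. ?w y z * \<psi> (?c y z))
        = (\<Sum>y\<in>UNIV. \<Sum>\<psi> | mult_char \<psi>. \<Sum>z\<in>UNIV. ?w y z * \<psi> (?c y z))"
      by (rule sum.swap)
    also have "\<dots> = (\<Sum>y\<in>UNIV. \<Sum>z\<in>UNIV. \<Sum>\<psi> | mult_char \<psi>. ?w y z * \<psi> (?c y z))"
      by (intro sum.cong refl sum.swap)
    finally show ?thesis by (simp only: sum_distrib_left[symmetric])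
  qed
  also have "\<dots> = C (- 1) / q\<^sup>2 *
      (\<Sum>y\<in>UNIV. \<Sum>z\<in>UNIV. ?w y z * (if ?c y z = 1 then q - 1 else 0))"
    by (simp only: sum_characters q)
  also have "\<dots> = C (- 1) / q\<^sup>2 * (\<Sum>y\<in>- {0, 1}.
      (q - 1) * (B y * inverse (C (1 - y)) * inverse (A (1 - x * (y / (y - 1))))))"
    unfolding inner sum.inter_restrict[OF finite, symmetric] by (simp only: Int_UNIV_left)
  also have "(\<Sum>y\<in>- {0, 1}. (q - 1) * (B y * inverse (C (1 - y)) * inverse (A (1 - x * (y / (y - 1))))))
      = (q - 1) * (\<Sum>y\<in>- {0, 1}. B y * inverse (C (1 - y)) * inverse (A (1 - x * (y / (y - 1)))))"
    by (simp add: sum_distrib_left)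
  also have "(\<Sum>y\<in>- {0, 1}. B y * inverse (C (1 - y)) * inverse (A (1 - x * (y / (y - 1)))))
      = (\<Sum>y\<in>- {0, 1}. B (- 1) * (B y * (inverse (B (1 - y)) * C (1 - y)) * inverse (A (1 - x * y))))"
  \<comment> \<open>The involution \<open>y \<mapsto> y / (y - 1)\<close> sends \<open>1 - y\<close>
    to its inverse and simplifies the argument of \<open>A\<close>. The sign in
    \<open>y / (y - 1) = - 1 * (y * inverse (1 - y))\<close> produces the factor
    \<open>B (- 1)\<close>.\<close>
  proof (rule sum.reindex_bij_witness[where i = "\<lambda>u. u / (u - 1)" and j = "\<lambda>y. y / (y - 1)"])
    fix y :: 'a assume y: "y \<in> - {0, 1}"
    then have y1: "y - 1 \<noteq> 0" "1 - y \<noteq> 0" by auto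
    have s: "y / (y - 1) - 1 = 1 / (y - 1)" using y1 by (simp add: field_simps)
    show "y / (y - 1) / (y / (y - 1) - 1) = y" using y1 by (simp add: s)
    then show "y / (y - 1) / (y / (y - 1) - 1) = y" .
    show "y / (y - 1) \<in> - {0, 1}" using y y1 s by auto
    then show "y / (y - 1) \<in> - {0, 1}" .
    have "1 - y / (y - 1) = inverse (1 - y)" using y1 by (simp add: field_simps)
    moreover have "y / (y - 1) = - 1 * (y * inverse (1 - y))" using y1 by (simp add: field_simps)
    moreover have "B (- 1) * B (- 1) = 1" using vals(5)[of "- 1" "- 1"] mult_char_1[OF B] by simp
    moreover have "B (1 - y) \<noteq> 0" using y1 B by (simp add: mult_char_def)
    ultimately show "B (- 1) * (B (y / (y - 1)) * (inverse (B (1 - y / (y - 1))) * C (1 - y / (y - 1)))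
          * inverse (A (1 - x * (y / (y - 1)))))
        = B y * inverse (C (1 - y)) * inverse (A (1 - x * (y / (y - 1))))"
      by (simp only: vals mult_char_inverse[OF B] mult_char_inverse[OF C] inverse_inverse_eq)
         (simp add: mult_ac)
  qed
  also have "\<dots> = B (- 1) *
      (\<Sum>y\<in>- {0, 1}. B y * (inverse (B (1 - y)) * C (1 - y)) * inverse (A (1 - x * y)))"
    by (simp add: sum_distrib_left)
  also have "(\<Sum>y\<in>- {0, 1}. B y * (inverse (B (1 - y)) * C (1 - y)) * inverse (A (1 - x * y)))
      = (\<Sum>y\<in>UNIV. B y * (inverse (B (1 - y)) * C (1 - y)) * inverse (A (1 - x * y)))"
    by (rule sum.mono_neutral_left) (auto simp: vals)
  finally show ?thesis
    using n_pos q0 q unfolding greene_2F1_def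
    by (simp add: power2_eq_square field_simps flip: q_def)
qed

section \<open>Eigenvalues of the convolution on the squares\<close>

lemma chi_pow: "x \<noteq> 0 \<Longrightarrow> char_pow \<chi> k x = \<chi> x powi k"
  by (simp add: char_pow_def)

lemma square_nonzero: "z \<in> nonzero_squares \<Longrightarrow> z \<noteq> (0::'a)"
  by (auto simp: nonzero_squares_def)

lemma square_mult_bij:
  assumes a: "a \<in> nonzero_squares"
  shows "bij_betw (\<lambda>z. a * z :: 'a) nonzero_squares nonzero_squares"
proof (rule bij_betwI[where g = "\<lambda>z. inverse a * z"])
  have "\<chi> a ^ n = 1" "a \<noteq> 0" using a by (simp_all add: square_iff square_nonzero)
  then show "(\<lambda>z. a * z) \<in> nonzero_squares \<rightarrow> nonzero_squares"
    "(\<lambda>z. inverse a * z) \<in> nonzero_squares \<rightarrow> nonzero_squares"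
    "\<And>z. inverse a * (a * z) = z" "\<And>z. a * (inverse a * z) = z"
    by (auto simp: square_iff chi_mult chi_inverse power_mult_distrib power_inverse)
qed

text \<open>\<open>1 + d * z\<close> may be zero, so its power is taken with
  \<open>char_pow\<close>, while \<open>z\<close> is a unit and plain \<open>powi\<close>
  suffices.\<close>

definition eigval :: "int \<Rightarrow> 'a \<Rightarrow> int \<Rightarrow> complex" where
  "eigval r d k = (\<Sum>z\<in>nonzero_squares. char_pow \<chi> r (1 + d * z) * \<chi> z powi k)"

text \<open>The power \<open>n\<close> of \<open>\<chi>\<close> is trivial on squares, so only
  \<open>k\<close> modulo \<open>n\<close> matters.\<close>

lemma eigval_periodic: "eigval r d (k + int n) = eigval r d k"
  unfolding eigval_def
  by (intro sum.cong refl)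
     (simp add: power_int_add chi_nonzero square_nonzero chi_power_n_square)

lemma eigval_square_scale:
  assumes d: "d \<in> nonzero_squares"
  shows "eigval r d k = \<chi> d powi (- k) * eigval r 1 k"
proof -
  have "eigval r 1 k = (\<Sum>z\<in>nonzero_squares. char_pow \<chi> r (1 + d * z) * \<chi> (d * z) powi k)"
    using sum.reindex_bij_betw[OF square_mult_bij[OF d], of "\<lambda>z. char_pow \<chi> r (1 + z) * \<chi> z powi k"]
    by (simp add: eigval_def)
  also have "\<dots> = \<chi> d powi k * eigval r d k"
    unfolding eigval_def sum_distrib_left
    by (intro sum.cong refl) (simp add: chi_mult power_int_mult_distrib mult_ac)
  finally show ?thesis
    using chi_nonzero[OF square_nonzero[OF d]] by (simp add: power_int_minus)
qed

text \<open>With \<open>d\<^sup>2\<close> in place of \<open>d\<close>, the substitution preserves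
  squares even for a nonsquare \<open>d\<close>. It turns \<open>1 + d * z\<close> into
  \<open>(1 + d * z) / (d * z)\<close>, whose denominator shifts the exponent of
  \<open>\<chi> z\<close> and leaves a power of \<open>\<chi> d\<close>.\<close>

lemma eigval_reflect:
  assumes d: "d \<noteq> 0"
  shows "eigval r d k = \<chi> d powi (- r - 2 * k) * eigval r d (- r - k)"
proof -
  have sq: "inverse (d\<^sup>2 * z) \<in> nonzero_squares" if "z \<in> nonzero_squares" for z
  proof -
    have "d\<^sup>2 \<in> nonzero_squares" using d by (auto simp: nonzero_squares_def)
    with that show ?thesis
      by (simp add: square_iff chi_mult chi_inverse power_mult_distrib power_inverse)
  qed
  show ?thesis
    unfolding eigval_def sum_distrib_left
  proof (rule sum.reindex_bij_witness[where i = "\<lambda>z. inverse (d\<^sup>2 * z)" and j = "\<lambda>z. inverse (d\<^sup>2 * z)"])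
    fix z :: 'a assume z: "z \<in> nonzero_squares"
    then have z0: "z \<noteq> 0" by (rule square_nonzero)
    have nz: "\<chi> d \<noteq> 0" "\<chi> z \<noteq> 0" using d z0 by (simp_all add: chi_nonzero)
    show "inverse (d\<^sup>2 * inverse (d\<^sup>2 * z)) = z" using d z0 by (simp add: field_simps)
    then show "inverse (d\<^sup>2 * inverse (d\<^sup>2 * z)) = z" .
    show "inverse (d\<^sup>2 * z) \<in> nonzero_squares" using sq z .
    then show "inverse (d\<^sup>2 * z) \<in> nonzero_squares" .
    have e: "1 + d * inverse (d\<^sup>2 * z) = (1 + d * z) * inverse (d * z)"
      using d z0 by (simp add: field_simps power2_eq_square)
    have 1: "char_pow \<chi> r (1 + d * inverse (d\<^sup>2 * z)) = char_pow \<chi> r (1 + d * z) * (\<chi> d powi (- r) * \<chi> z powi (- r))"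
    proof (cases "1 + d * z = 0")
      case False
      then show ?thesis
        unfolding e using d z0
        by (simp add: chi_pow chi_mult chi_inverse power_int_mult_distrib power_int_minus power_int_inverse)
    qed (unfold e, simp add: char_pow_def)
    have 2: "\<chi> (inverse (d\<^sup>2 * z)) powi (- r - k) = \<chi> d powi (2 * r + 2 * k) * \<chi> z powi (r + k)"
    proof -
      have "\<chi> (inverse (d\<^sup>2 * z)) powi (- r - k) = (\<chi> d ^ 2 * \<chi> z) powi (r + k)"
        by (metis chi_inverse chi_mult chi_power power_int_inverse power_int_minus inverse_inverse_eq
            minus_add_distrib diff_conv_add_uminus)
      also have "\<dots> = (\<chi> d powi 2) powi (r + k) * \<chi> z powi (r + k)"
        by (simp add: power_int_mult_distrib)
      also have "(\<chi> d powi 2) powi (r + k) = \<chi> d powi (2 * r + 2 * k)"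
        by (metis power_int_mult distrib_left)
      finally show ?thesis .
    qed
    have 3: "\<chi> d powi (- r - 2 * k) * (\<chi> d powi (- r) * \<chi> d powi (2 * r + 2 * k)) = 1"
      using nz by (simp flip: power_int_add)
    have 4: "\<chi> z powi (- r) * \<chi> z powi (r + k) = \<chi> z powi k"
      using nz by (simp flip: power_int_add)
    \<comment> \<open>The rearrangement groups the powers of \<open>\<chi> d\<close>, which cancel
      by \<open>3\<close>, and those of \<open>\<chi> z\<close>, which combine by
      \<open>4\<close>.\<close>
    have "a * ((u * (b * e)) * (c * f)) = (a * (b * c)) * (u * (e * f))" for a b c e f u :: complex
      by (simp add: mult_ac)
    then show "\<chi> d powi (- r - 2 * k) * (char_pow \<chi> r (1 + d * inverse (d\<^sup>2 * z))
        * \<chi> (inverse (d\<^sup>2 * z)) powi (- r - k)) = char_pow \<chi> r (1 + d * z) * \<chi> z powi k"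
      by (simp only: 1 2 3 4 mult_1)
  qed
qed

text \<open>For this \<open>k\<close> the reflected exponent \<open>- r - k\<close> equals
  \<open>k - int n\<close>, so periodicity makes \<open>eigval r d k\<close> a multiple of itself,
  with factor \<open>- 1\<close> because \<open>d\<close> is a nonsquare.\<close>

lemma eigval_vanish:
  assumes d: "d \<notin> nonzero_squares" "d \<noteq> 0" and k: "r + 2 * k = int n"
  shows "eigval r d k = 0"
proof -
  have "- r - 2 * k = - int n" "- r - k + int n = k" using k by auto
  then have "eigval r d k = \<chi> d powi (- int n) * eigval r d k"
    using eigval_reflect[OF d(2), of r k] eigval_periodic[of r d "- r - k"] by metis
  also have "\<chi> d powi (- int n) = - 1"
    using d by (simp add: power_int_minus chi_power_n)
  finally show ?thesis by simp
qed

end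

section \<open>The determinant by diagonalisation\<close>

lemma det_mat_diag: "det (mat_diag n f) = (\<Prod>i<n. f i)"
proof -
  have "det (mat_diag n f) = prod_list (diag_mat (mat_diag n f))"
    by (rule det_upper_triangular[where n = n]) (auto simp: mat_diag_def)
  also have "\<dots> = (\<Prod>i<n. f i)"
    by (simp add: prod_list_diag_prod mat_diag_def lessThan_atLeast0)
  finally show ?thesis .
qed

context character_generator
begin

text \<open>The squares form a cyclic group of order \<open>n\<close>, and the vectors \<open>(\<chi>\<^sup>k(\<alpha>\<^sub>1), \<dots>, \<chi>\<^sup>k(\<alpha>\<^sub>n))\<close>
  diagonalise the matrix \<open>\<chi>\<^sup>r(1 + d \<alpha>\<^sub>j / \<alpha>\<^sub>i)\<close>, with eigenvalues \<^term>\<open>eigval r d k\<close>.\<close>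

lemma det_character_sum:
  assumes \<alpha>: "bij_betw \<alpha> {1..n} nonzero_squares"
  shows "S_det n \<alpha> \<chi> r d = (- 1) ^ (r * (n + 1)) * (\<Prod>k=1..n. eigval (int r) d (int k + s))"
proof -
  define a where "a i = \<alpha> (i + 1)" for i
  \<comment> \<open>Matrix indices start at \<open>0\<close>, so \<open>k + 1\<close> matches the
    product over \<open>1..n\<close>. The shift \<open>s\<close> selects the window of
    \<open>n\<close> exponents.\<close>
  define e where "e k = int (k + 1) + s" for k
  define M where "M = mat n n (\<lambda>(i, j). char_pow \<chi> (int r) (a i + d * a j))"
  define V where "V = mat n n (\<lambda>(i, k). \<chi> (a i) powi e k)"
  define W where "W = mat n n (\<lambda>(k, j). \<chi> (a j) powi (- e k))"
  have car: "M \<in> carrier_mat n n" "V \<in> carrier_mat n n" "W \<in> carrier_mat n n"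
    by (simp_all add: M_def V_def W_def)
  have a_bij: "bij_betw a {..<n} nonzero_squares"
  proof -
    have "bij_betw Suc {..<n} {1..n}"
      by (simp add: bij_betw_def image_Suc_lessThan)
    from bij_betw_trans[OF this \<alpha>] show ?thesis by (simp add: a_def[abs_def] comp_def)
  qed
  have a: "a i \<in> nonzero_squares" "a i \<noteq> 0" "\<chi> (a i) \<noteq> 0" if "i < n" for i
    using bij_betwE[OF a_bij] that by (auto simp: square_nonzero chi_nonzero)
  have a_inj: "a i = a j \<longleftrightarrow> i = j" if "i < n" "j < n" for i j
    using a_bij that by (auto simp: bij_betw_def inj_on_def)
  \<comment> \<open>The entries are geometric sums of the \<open>n\<close>-th root of unity
    \<open>w\<close>, which is \<open>1\<close> only on the diagonal. This yields
    \<open>det V \<noteq> 0\<close>, so that \<open>det V\<close> can be cancelled at the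
    end.\<close>
  have "V * W = mat_diag n (\<lambda>_. of_nat n)"
  proof (rule eq_matI)
    fix i j assume "i < dim_row (mat_diag n (\<lambda>_. of_nat n :: complex))"
      "j < dim_col (mat_diag n (\<lambda>_. of_nat n :: complex))"
    then have ij: "i < n" "j < n" by (simp_all add: mat_diag_def)
    define w where "w = \<chi> (a i) / \<chi> (a j)"
    have w0: "w \<noteq> 0" and wn: "w ^ n = 1"
      using a ij by (simp_all add: w_def power_divide chi_power_n_square)
    have w1: "w = 1 \<longleftrightarrow> i = j"
    proof -
      have "w = \<chi> (a i * inverse (a j))"
        by (simp add: w_def chi_mult chi_inverse divide_inverse)
      also have "\<dots> = 1 \<longleftrightarrow> a i = a j"
        using a(2)[OF ij(2)] by (simp add: chi_eq_1_iff field_simps)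
      finally show ?thesis using a_inj ij by simp
    qed
    have "(V * W) $$ (i, j) = (\<Sum>k<n. \<chi> (a i) powi e k * \<chi> (a j) powi (- e k))"
      using ij by (simp add: V_def W_def scalar_prod_def lessThan_atLeast0)
    also have "\<dots> = (\<Sum>k<n. w powi (1 + s) * w ^ k)"
    proof (rule sum.cong[OF refl])
      fix k
      have "\<chi> (a i) powi e k * \<chi> (a j) powi (- e k) = w powi e k"
        by (simp add: w_def divide_inverse power_int_mult_distrib power_int_inverse power_int_minus)
      also have "\<dots> = w powi ((1 + s) + int k)" by (simp add: e_def add_ac)
      finally show "\<chi> (a i) powi e k * \<chi> (a j) powi (- e k) = w powi (1 + s) * w ^ k"
        using w0 by (simp add: power_int_add)
    qed
    also have "\<dots> = w powi (1 + s) * (\<Sum>k<n. w ^ k)" by (simp add: sum_distrib_left)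
    also have "(\<Sum>k<n. w ^ k) = (if i = j then of_nat n else 0)"
      using w1 wn by (simp add: sum_gp_strict)
    finally show "(V * W) $$ (i, j) = mat_diag n (\<lambda>_. of_nat n) $$ (i, j)"
      using ij w1 by (cases "i = j") (simp_all add: mat_diag_def)
  qed (simp_all add: V_def W_def mat_diag_def)
  then have "det V * det W = of_nat n ^ n"
    using det_mult[OF car(2,3)] by (simp add: det_mat_diag)
  then have detV: "det V \<noteq> 0" using n_pos by auto
  \<comment> \<open>The columns of \<open>V\<close> are eigenvectors up to the row factors
    \<open>\<chi> (a i) ^ r\<close>, which appear when \<open>z\<close> is replaced by
    \<open>a i * z\<close> and \<open>a i\<close> is pulled out of the sum.\<close>
  have "M * V = mat_diag n (\<lambda>i. \<chi> (a i) ^ r) * V * mat_diag n (\<lambda>k. eigval (int r) d (e k))"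
    (is "_ = ?D * V * ?L")
  proof (rule eq_matI)
    fix i k assume "i < dim_row (?D * V * ?L)" "k < dim_col (?D * V * ?L)"
    then have ik: "i < n" "k < n" by (simp_all add: mat_diag_def)
    have "(M * V) $$ (i, k) = (\<Sum>j<n. char_pow \<chi> (int r) (a i + d * a j) * \<chi> (a j) powi e k)"
      using ik by (simp add: M_def V_def scalar_prod_def lessThan_atLeast0)
    also have "\<dots> = (\<Sum>z\<in>nonzero_squares. char_pow \<chi> (int r) (a i + d * z) * \<chi> z powi e k)"
      by (rule sum.reindex_bij_betw[OF a_bij])
    also have "\<dots> = (\<Sum>z\<in>nonzero_squares.
        char_pow \<chi> (int r) (a i + d * (a i * z)) * \<chi> (a i * z) powi e k)"
      by (rule sum.reindex_bij_betw[OF square_mult_bij, symmetric]) (rule a(1)[OF ik(1)])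
    also have "\<dots> = \<chi> (a i) ^ r * \<chi> (a i) powi e k * eigval (int r) d (e k)"
      unfolding eigval_def sum_distrib_left
    proof (rule sum.cong[OF refl])
      fix z :: 'a
      have "a i + d * (a i * z) = a i * (1 + d * z)" by (simp add: algebra_simps)
      then have "char_pow \<chi> (int r) (a i + d * (a i * z)) = \<chi> (a i) ^ r * char_pow \<chi> (int r) (1 + d * z)"
        using mult_char_pow[OF mult_char, of "int r"] chi_pow[OF a(2)[OF ik(1)], of "int r"]
        by (simp add: mult_char_def)
      then show "char_pow \<chi> (int r) (a i + d * (a i * z)) * \<chi> (a i * z) powi e k
          = \<chi> (a i) ^ r * \<chi> (a i) powi e k * (char_pow \<chi> (int r) (1 + d * z) * \<chi> z powi e k)"
        by (simp add: chi_mult power_int_mult_distrib)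
    qed
    also have "\<dots> = (?D * V * ?L) $$ (i, k)"
      using ik car(2)
      by (simp add: mat_diag_mult_left[of _ n n] mat_diag_mult_right[of _ n n] V_def)
    finally show "(M * V) $$ (i, k) = (?D * V * ?L) $$ (i, k)" .
  qed (simp_all add: M_def V_def mat_diag_def)
  then have "det M * det V = det (?D * V * ?L)"
    by (metis det_mult[OF car(1,2)])
  also have "\<dots> = det (?D * V) * det ?L"
    by (rule det_mult[where n = n]) (use car(2) in \<open>auto intro!: mult_carrier_mat[of _ n n]\<close>)
  also have "det (?D * V) = det ?D * det V"
    by (rule det_mult[where n = n]) (use car(2) in \<open>auto intro!: mult_carrier_mat[of _ n n]\<close>)
  finally have "det M * det V = (\<Prod>i<n. \<chi> (a i) ^ r) * det V * (\<Prod>k<n. eigval (int r) d (e k))"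
    by (simp only: det_mat_diag)
  then have "det M = (\<Prod>i<n. \<chi> (a i) ^ r) * (\<Prod>k<n. eigval (int r) d (e k))"
    using detV by simp
  moreover have "(\<Prod>i<n. \<chi> (a i) ^ r) = (- 1) ^ (r * (n + 1))"
    using prod.reindex_bij_betw[OF a_bij, of \<chi>] prod_chi_squares
    by (simp only: prod_power_distrib[symmetric] power_mult[symmetric] mult.commute[of r])
  moreover have "(\<Prod>k<n. eigval (int r) d (e k)) = (\<Prod>k=1..n. eigval (int r) d (int k + s))"
    by (simp add: e_def prod.atLeast1_atMost_eq)
  ultimately show ?thesis by (simp add: S_det_def M_def a_def)
qed

lemma chi_pow_minus_1: "char_pow \<chi> k (- 1) = (- 1) powi k"
  by (simp add: chi_pow chi_minus_1)

section \<open>Vanishing and scaling of the determinant\<close>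

lemma S_det_nonsquare:
  assumes "d \<notin> nonzero_squares" "d \<noteq> 0" "r mod 2 = n mod 2" "bij_betw \<alpha> {1..n} nonzero_squares"
  shows "S_det n \<alpha> \<chi> r d = 0"
proof -
  have "even (int n - int r)" using assms(3) by presburger
  then obtain k where "int n - int r = 2 * k" by (rule evenE)
  then have k: "int r + 2 * k = int n" by simp
  \<comment> \<open>The shift \<open>k - 1\<close> places the vanishing eigenvalue at index
    \<open>1\<close> of the product.\<close>
  have "eigval (int r) d (int 1 + (k - 1)) = 0"
    using eigval_vanish[OF assms(1,2) k] by simp
  then have "(\<Prod>j=1..n. eigval (int r) d (int j + (k - 1))) = 0"
    using n_pos by (intro prod_zero) (auto intro!: bexI[of _ 1])
  then show ?thesis using det_character_sum[OF assms(4), of r d "k - 1"] by simp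
qed

lemma gauss_sum_from_1: "(\<Sum>k=1..n. k) = n * (n + 1) div (2::nat)"
  using gauss_sum_nat[of n] by (simp add: atMost_atLeast0 sum.atLeast_Suc_atMost)

lemma chi_square_root_power:
  "\<chi> (y\<^sup>2) ^ (n * (n + 1) div 2) = (\<chi> y ^ n) ^ (n + 1)"
proof -
  have "2 * (n * (n + 1) div 2) = n * (n + 1)" by simp
  then show ?thesis by (simp only: chi_power power_mult[symmetric])
qed

text \<open>The scaling factors of the eigenvalues multiply to the inverse of
  \<open>\<chi> (y\<^sup>2)\<close> to the power \<open>n * (n + 1) div 2\<close>. The square clears
  the halving, and what remains is a sign, hence its own inverse.\<close>

lemma S_det_square_scale:
  assumes \<alpha>: "bij_betw \<alpha> {1..n} nonzero_squares" and y: "y \<noteq> 0"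
  shows "S_det n \<alpha> \<chi> r (y\<^sup>2) = (\<chi> y ^ n) ^ (n + 1) * S_det n \<alpha> \<chi> r 1"
proof -
  have d: "y\<^sup>2 \<in> nonzero_squares" using y by (auto simp: nonzero_squares_def)
  have "(\<Prod>k=1..n. eigval (int r) (y\<^sup>2) (int k + 0))
      = (\<Prod>k=1..n. inverse (\<chi> (y\<^sup>2) ^ k) * eigval (int r) 1 (int k + 0))"
    by (intro prod.cong refl) (simp add: eigval_square_scale[OF d] power_int_minus)
  also have "\<dots> = inverse (\<chi> (y\<^sup>2) ^ (\<Sum>k=1..n. k)) * (\<Prod>k=1..n. eigval (int r) 1 (int k + 0))"
    by (simp add: prod.distrib prod_inversef[symmetric] power_sum o_def)
  also note gauss_sum_from_1
  also have "inverse (\<chi> (y\<^sup>2) ^ (n * (n + 1) div 2)) = (\<chi> y ^ n) ^ (n + 1)"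
    using y unfolding chi_square_root_power by (simp add: chi_power_n power_inverse[symmetric])
  finally show ?thesis
    using det_character_sum[OF \<alpha>, of r "y\<^sup>2" 0] det_character_sum[OF \<alpha>, of r 1 0] by simp
qed

text \<open>The square roots of \<open>y\<^sup>2\<close> are \<open>y\<close> and
  \<open>- y\<close>, and \<open>- 1\<close> is a square for even \<open>n\<close>, so the question
  is only whether \<open>y\<close> is a square.\<close>

lemma fourth_power_iff:
  assumes "even n" "y \<noteq> 0"
  shows "(\<exists>x. y\<^sup>2 = x ^ 4) \<longleftrightarrow> \<chi> y ^ n = 1"
proof
  assume "\<exists>x. y\<^sup>2 = x ^ 4"
  then obtain x where "y\<^sup>2 = (x\<^sup>2)\<^sup>2" by auto
  then have "y = x\<^sup>2 \<or> y = - (x\<^sup>2)" by (simp only: power2_eq_iff)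
  then have "y = x\<^sup>2 \<or> y = - 1 * x\<^sup>2" by simp
  moreover from this have "x \<noteq> 0" using assms by auto
  then have "\<chi> (x\<^sup>2) ^ n = 1" by (auto simp: square_iff[symmetric] nonzero_squares_def)
  moreover have "\<chi> (- 1) ^ n = 1" using assms by (simp add: chi_minus_1)
  ultimately show "\<chi> y ^ n = 1" by (auto simp only: chi_mult power_mult_distrib mult_1)
next
  assume "\<chi> y ^ n = 1"
  then obtain x where "y = x\<^sup>2" by (auto simp: square_iff[symmetric] nonzero_squares_def)
  then show "\<exists>x. y\<^sup>2 = x ^ 4" by (intro exI[of _ x]) simp
qed

section \<open>Greene's function at \<open>1\<close> and at \<open>- 1\<close>\<close>

text \<open>The two sums differ only in a character at \<open>1 - y\<close>, which is
  \<open>- z\<close> after \<open>y = 1 + z\<close>. For odd \<open>n\<close> the element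
  \<open>- 1\<close> is a nonsquare, so the trivial minus the quadratic character at
  \<open>- z\<close> is \<open>2\<close> on nonzero squares \<open>z\<close> and \<open>0\<close>
  elsewhere.\<close>

lemma greene_2F1_difference_at_1:
  assumes n: "odd n"
  shows "greene_2F1 triv_char (char_pow \<chi> r) (char_pow \<chi> k) 1
      - greene_2F1 quad_char (char_pow \<chi> r) (char_pow \<chi> k) 1
    = 2 / of_nat CARD('a) * eigval r 1 (k - r)"
proof -
  let ?c = "char_pow \<chi> r (- 1) * char_pow \<chi> k (- 1) / of_nat CARD('a)"
  let ?t = "\<lambda>y. char_pow \<chi> r y * (inverse (char_pow \<chi> r (1 - y)) * char_pow \<chi> k (1 - y))"
  have "greene_2F1 triv_char (char_pow \<chi> r) (char_pow \<chi> k) 1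
      - greene_2F1 quad_char (char_pow \<chi> r) (char_pow \<chi> k) 1
    = ?c * (\<Sum>y\<in>UNIV. ?t y * (inverse (triv_char (1 - y)) - inverse (char_pow \<chi> (int n) (1 - y))))"
    using mult_char
    by (simp add: greene_2F1_integral mult_char_triv mult_char_pow quad_char_eq
        right_diff_distrib sum_subtractf)
  also have "(\<Sum>y\<in>UNIV. ?t y * (inverse (triv_char (1 - y)) - inverse (char_pow \<chi> (int n) (1 - y))))
      = (\<Sum>z\<in>UNIV. ?t (1 + z) * (inverse (triv_char (- z)) - inverse (char_pow \<chi> (int n) (- z))))"
    by (rule sum.reindex_bij_witness[where i = "\<lambda>z. 1 + z" and j = "\<lambda>y. y - 1"]) simp_all
  also have "\<dots> = (\<Sum>z\<in>nonzero_squares. (- 1) powi (k - r) * 2 * (char_pow \<chi> r (1 + 1 * z) * \<chi> z powi (k - r)))"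
  proof (rule sum.mono_neutral_cong_right)
    have chi_minus: "\<chi> (- z) = - \<chi> z" for z
      using chi_mult[of "- 1" z] by (simp add: chi_minus_1)
    show "\<forall>z\<in>UNIV - nonzero_squares.
        ?t (1 + z) * (inverse (triv_char (- z)) - inverse (char_pow \<chi> (int n) (- z))) = 0"
    proof
      fix z :: 'a assume z: "z \<in> UNIV - nonzero_squares"
      have "\<chi> (- z) ^ n = 1" if "z \<noteq> 0"
        using z that n by (simp add: chi_minus chi_power_n)
      then show "?t (1 + z) * (inverse (triv_char (- z)) - inverse (char_pow \<chi> (int n) (- z))) = 0"
        by (auto simp: triv_char_def char_pow_def)
    qed
    fix z :: 'a assume z: "z \<in> nonzero_squares"
    then have z0: "z \<noteq> 0" "\<chi> z \<noteq> 0" by (simp_all add: square_nonzero chi_nonzero)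
    have "inverse (char_pow \<chi> r (- z)) * char_pow \<chi> k (- z) = (- 1 * \<chi> z) powi (k - r)"
      using z0 by (simp add: chi_pow chi_minus power_int_diff divide_inverse mult.commute)
    also have "\<dots> = (- 1) powi (k - r) * \<chi> z powi (k - r)"
      by (rule power_int_mult_distrib)
    finally have t: "?t (1 + z) = char_pow \<chi> r (1 + z) * ((- 1) powi (k - r) * \<chi> z powi (k - r))"
      by simp
    have "inverse (triv_char (- z)) - inverse (char_pow \<chi> (int n) (- z)) = 2"
      using z0 z n by (simp add: triv_char_def chi_pow chi_minus chi_power_n)
    then show "?t (1 + z) * (inverse (triv_char (- z)) - inverse (char_pow \<chi> (int n) (- z)))
        = (- 1) powi (k - r) * 2 * (char_pow \<chi> r (1 + 1 * z) * \<chi> z powi (k - r))"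
      by (simp only: t) simp
  qed simp_all
  also have "\<dots> = (- 1) powi (k - r) * 2 * eigval r 1 (k - r)"
    unfolding eigval_def sum_distrib_left ..
  also have "?c * \<dots> = ((- 1) powi r * (- 1) powi k * (- 1) powi (k - r)) * (2 / of_nat CARD('a) * eigval r 1 (k - r))"
    by (simp add: chi_pow_minus_1)
  \<comment> \<open>The three exponents add up to the even number \<open>2 * k\<close>.\<close>
  also have "(- 1) powi r * (- 1) powi k * (- 1) powi (k - r) = (1 :: complex)"
    by (simp add: power_int_minus_left flip: power_int_add)
  finally show ?thesis by simp
qed

text \<open>With these parameters \<open>1 - y\<close> and \<open>1 + y\<close> both carry the
  exponent \<open>r\<close>. Their product \<open>1 - y\<^sup>2\<close> and the even power of
  \<open>\<chi> y\<close> make the summand a function of \<open>y\<^sup>2\<close>.\<close>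

lemma greene_2F1_at_minus_1:
  assumes n: "even n"
  shows "greene_2F1 (char_pow \<chi> (- r)) (char_pow \<chi> (2 * k - 2 * r)) (char_pow \<chi> (2 * k - r)) (- 1)
    = (- 1) powi k * (2 / of_nat CARD('a) * eigval r 1 (k - r))"
proof -
  let ?B = "char_pow \<chi> (2 * k - 2 * r)" and ?C = "char_pow \<chi> (2 * k - r)"
  have m1: "- 1 \<in> (nonzero_squares :: 'a set)"
    using n by (simp add: square_iff chi_minus_1)
  have "(\<Sum>y\<in>UNIV. ?B y * (inverse (?B (1 - y)) * ?C (1 - y)) * inverse (char_pow \<chi> (- r) (1 - (- 1) * y)))
    = (\<Sum>y\<in>- {0}. char_pow \<chi> r (1 - y\<^sup>2) * \<chi> (y\<^sup>2) powi (k - r))"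
  proof (rule sum.mono_neutral_cong_right)
    fix y :: 'a assume y: "y \<in> - {0}"
    have "?B y = (\<chi> y powi 2) powi (k - r)"
      using y by (simp only: power_int_mult[symmetric]) (simp add: chi_pow algebra_simps)
    also have "\<chi> y powi 2 = \<chi> (y\<^sup>2)" by (simp add: chi_power)
    finally have By: "?B y = \<chi> (y\<^sup>2) powi (k - r)" .
    have 1: "inverse (?B (1 - y)) * ?C (1 - y) = char_pow \<chi> r (1 - y)"
    proof (cases "1 - y = 0")
      case False
      then have "inverse (?B (1 - y)) * ?C (1 - y) = \<chi> (1 - y) powi (- (2 * k - 2 * r) + (2 * k - r))"
        by (subst power_int_add) (simp_all add: chi_pow chi_nonzero flip: power_int_minus)
      with False show ?thesis by (simp add: chi_pow)
    qed (simp add: char_pow_def)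
    have 2: "inverse (char_pow \<chi> (- r) (1 - (- 1) * y)) = char_pow \<chi> r (1 + y)"
      by (simp add: char_pow_def power_int_minus)
    have 3: "char_pow \<chi> r (1 - y) * char_pow \<chi> r (1 + y) = char_pow \<chi> r (1 - y\<^sup>2)"
    proof -
      have "1 - y\<^sup>2 = (1 - y) * (1 + y)" by (simp add: algebra_simps power2_eq_square)
      then show ?thesis using mult_char_pow[OF mult_char, of r] by (simp add: mult_char_def)
    qed
    show "?B y * (inverse (?B (1 - y)) * ?C (1 - y)) * inverse (char_pow \<chi> (- r) (1 - (- 1) * y))
        = char_pow \<chi> r (1 - y\<^sup>2) * \<chi> (y\<^sup>2) powi (k - r)"
      unfolding By 1 2 mult.assoc 3 by (rule mult.commute)
  qed (simp_all add: char_pow_def)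
  also have "\<dots> = (\<Sum>z\<in>nonzero_squares. 2 * (char_pow \<chi> r (1 - z) * \<chi> z powi (k - r)))"
    by (rule sum_squares)
  \<comment> \<open>As \<open>- 1\<close> is a square, \<open>z\<close> may be replaced by
    \<open>- z\<close>, which turns \<open>1 - z\<close> into \<open>1 + z\<close> at the cost of a
    sign.\<close>
  also have "\<dots> = (\<Sum>z\<in>nonzero_squares. 2 * (char_pow \<chi> r (1 - (- 1 * z)) * \<chi> (- 1 * z) powi (k - r)))"
    by (rule sum.reindex_bij_betw[OF square_mult_bij[OF m1], symmetric])
  also have "\<dots> = 2 * (- 1) powi (k - r) * eigval r 1 (k - r)"
    unfolding eigval_def sum_distrib_left chi_mult chi_minus_1 power_int_mult_distrib
    by (intro sum.cong refl) simp
  finally have "greene_2F1 (char_pow \<chi> (- r)) ?B ?C (- 1)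
      = ?B (- 1) * ?C (- 1) / of_nat CARD('a) * (2 * (- 1) powi (k - r) * eigval r 1 (k - r))"
    by (subst greene_2F1_integral) (simp_all add: mult_char_pow mult_char)
  also have "\<dots> = (- 1) powi (2 * k - 2 * r) * (- 1) powi (2 * k - r) * (- 1) powi (k - r)
      * (2 / of_nat CARD('a) * eigval r 1 (k - r))"
    by (simp add: chi_pow_minus_1)
  \<comment> \<open>The exponents add up to \<open>5 * k - 4 * r\<close>, which has the parity of
    \<open>k\<close>.\<close>
  also have "(- 1) powi (2 * k - 2 * r) * (- 1) powi (2 * k - r) * (- 1) powi (k - r) = ((- 1) powi k :: complex)"
    by (simp add: power_int_minus_left flip: power_int_add)
  finally show ?thesis .
qed

end

section \<open>The three evaluations of the determinant\<close>

theorem theorem1p1: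
  fixes n r :: nat
    and \<chi> :: "'a::{field,finite} \<Rightarrow> complex"
    and \<alpha> :: "nat \<Rightarrow> 'a"
    and d :: 'a
  assumes q: "CARD('a) = 2 * n + 1"
    and gen: "char_generator \<chi>"
    and squares: "bij_betw \<alpha> {1..n} nonzero_squares"
    and d: "d \<noteq> 0"
    and r: "1 \<le> r" "r \<le> CARD('a) - 2"
  shows
    "(d \<notin> nonzero_squares \<and> r mod 2 = n mod 2 \<longrightarrow> S_det n \<alpha> \<chi> r d = 0) \<and>
     (d \<in> nonzero_squares \<and> CARD('a) mod 4 = 3 \<longrightarrow>
        S_det n \<alpha> \<chi> r d = S_det n \<alpha> \<chi> r 1 \<and>
        S_det n \<alpha> \<chi> r 1 =
          of_nat CARD('a) ^ n / 2 ^ n *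
          (\<Prod>k = 1..n.
             greene_2F1 triv_char (char_pow \<chi> (int r)) (char_pow \<chi> (int k)) 1
             - greene_2F1 quad_char (char_pow \<chi> (int r)) (char_pow \<chi> (int k)) 1)) \<and>
     (d \<in> nonzero_squares \<and> CARD('a) mod 4 = 1 \<longrightarrow>
        S_det n \<alpha> \<chi> r d = (if \<exists>x. d = x ^ 4 then 1 else - 1) * S_det n \<alpha> \<chi> r 1 \<and>
        S_det n \<alpha> \<chi> r 1 =
          of_nat CARD('a) ^ n * (- 1) ^ (r + n * (n + 1) div 2) / 2 ^ n *
          (\<Prod>k = 1..n.
             greene_2F1 (char_pow \<chi> (- int r)) (char_pow \<chi> (2 * int k - 2 * int r))
               (char_pow \<chi> (2 * int k - int r)) (- 1)))"
proof -
  obtain g :: 'a where g: "g \<noteq> 0" "\<And>x. x \<noteq> 0 \<Longrightarrow> \<exists>i::nat. x = g ^ i"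
    using units_generator_exists by blast
  interpret character_generator n \<chi> g
    by unfold_locales (use q gen g in auto)
  \<comment> \<open>The shift \<open>- r\<close> is chosen because Greene's functions evaluate to
    \<open>eigval\<close> at \<open>k - r\<close>.\<close>
  define P where "P = (\<Prod>k=1..n. eigval (int r) 1 (int k + - int r))"
  have S1: "S_det n \<alpha> \<chi> r 1 = (- 1) ^ (r * (n + 1)) * P"
    unfolding P_def by (rule det_character_sum[OF squares])
  have c: "of_nat CARD('a) \<noteq> (0 :: complex)" by simp
  have prod_c: "(\<Prod>k=1..n. 2 / of_nat CARD('a) * eigval (int r) 1 (int k - int r))
      = (2 / of_nat CARD('a)) ^ n * P"
    unfolding P_def prod.distrib by simp
  show ?thesis
  proof (intro conjI impI; elim conjE)
    assume "d \<notin> nonzero_squares" "r mod 2 = n mod 2"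
    then show "S_det n \<alpha> \<chi> r d = 0" using S_det_nonsquare d squares by blast
  next
    assume "CARD('a) mod 4 = 3"
    then have n: "odd n" using q by presburger
    have sgn: "(- 1 :: complex) ^ (r * (n + 1)) = 1" using n by simp
    show "S_det n \<alpha> \<chi> r 1 = of_nat CARD('a) ^ n / 2 ^ n *
          (\<Prod>k = 1..n.
             greene_2F1 triv_char (char_pow \<chi> (int r)) (char_pow \<chi> (int k)) 1
             - greene_2F1 quad_char (char_pow \<chi> (int r)) (char_pow \<chi> (int k)) 1)"
      unfolding greene_2F1_difference_at_1[OF n] prod_c S1 sgn
      using c by (simp add: power_divide)
    assume "d \<in> nonzero_squares"
    then obtain y where "d = y\<^sup>2" "y \<noteq> 0" by (auto simp: nonzero_squares_def)
    \<comment> \<open>Since \<open>n + 1\<close> is even, the sign in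
      \<open>S_det_square_scale\<close> is \<open>1\<close>.\<close>
    then show "S_det n \<alpha> \<chi> r d = S_det n \<alpha> \<chi> r 1"
      using n by (simp add: S_det_square_scale[OF squares] chi_power_n)
  next
    assume "CARD('a) mod 4 = 1"
    then have n: "even n" using q by presburger
    have sgn: "(- 1 :: complex) ^ (r * (n + 1)) = (- 1) ^ r"
      using n unfolding mult.commute[of r] power_mult by simp
    \<comment> \<open>This is the product of the signs in \<open>greene_2F1_at_minus_1\<close>. Its
      square is \<open>1\<close>, so it appears as a prefactor when the equation is solved for the
      determinant.\<close>
    have sum: "(\<Prod>k=1..n. (- 1) powi int k) = (- 1 :: complex) ^ (n * (n + 1) div 2)"
    proof -
      have "(\<Prod>k=1..n. (- 1) powi int k) = (- 1 :: complex) ^ (\<Sum>k=1..n. k)" by (simp add: power_sum)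
      also note gauss_sum_from_1
      finally show ?thesis .
    qed
    show "S_det n \<alpha> \<chi> r 1 = of_nat CARD('a) ^ n * (- 1) ^ (r + n * (n + 1) div 2) / 2 ^ n *
          (\<Prod>k = 1..n.
             greene_2F1 (char_pow \<chi> (- int r)) (char_pow \<chi> (2 * int k - 2 * int r))
               (char_pow \<chi> (2 * int k - int r)) (- 1))"
      unfolding greene_2F1_at_minus_1[OF n] prod.distrib[of "\<lambda>k. (- 1) powi int k"] prod_c sum S1 sgn
      using c by (simp add: power_divide power_add)
    assume "d \<in> nonzero_squares"
    then obtain y where y: "d = y\<^sup>2" "y \<noteq> 0" by (auto simp: nonzero_squares_def)
    \<comment> \<open>For even \<open>n\<close> the sign \<open>(\<chi> y ^ n) ^ (n + 1)\<close> is
      \<open>\<chi> y ^ n\<close>, which is \<open>1\<close> exactly if \<open>d\<close> is a fourth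
      power.\<close>
    then show "S_det n \<alpha> \<chi> r d = (if \<exists>x. d = x ^ 4 then 1 else - 1) * S_det n \<alpha> \<chi> r 1"
      using n fourth_power_iff[OF n y(2)] chi_power_n[OF y(2)]
      by (auto simp: S_det_square_scale[OF squares])
  qed
qed

end
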